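(* Let $\theta>0$, $\theta\ne1$, and let $k\ge1$. For $N\ge k+2$, $$W_1^*(N,k)=(P_{N-2})!\,\theta^{N-k-2}\Big(\frac{1-\theta^{N-k-1}}{1-\theta}+\sum_{j=1}^{N-k-2}\frac{1-\theta^{N-k-1-j}}{1-\theta}\cdot\frac{1-\theta^k}{1-\theta^{k+j}}\Big),$$ (i.e. the terms $\frac{1-\theta^{N-k-1}}{1-\theta}+\frac{1-\theta^{N-k-2}}{1-\theta}\frac{1-\theta^k}{1-\theta^{k+1}}+\cdots+\frac{1-\theta}{1-\theta}\frac{1-\theta^k}{1-\theta^{N-2}}$), and $W_1^*(k+1,k)=0$, $W_1^*(k+2,k)=(P_k)!$.
   Context: $\mathrm{inv}(\pi)$ is the number of pairs $i<j$ with $\pi_i>\pi_j$. $P_n=1+\theta+\cdots+\theta^{n-1}$, $(P_n)!=P_n\cdots P_1$. For $\pi\in S_n$, position $i$ is a left-to-right maximum if $\pi_i>\pi_j$ for all $j<i$. The strategy $S^1_k$ rejects the first $k$ candidates and then accepts the first subsequent left-to-right maximum (if any). $\pi\in S_n$ is $k$-winnable if $S^1_k$ selects a position holding value $n-1$. $W_1^*(n,k)=\sum_{\pi\in S_n\ k\text{-winnable}}\theta^{\mathrm{inv}(\pi)}$. *)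

theory Defs
  imports Complex_Main "HOL-Combinatorics.Permutations"
begin

text \<open>
  A permutation in \<open>S\<^sub>n\<close> is a function \<open>\<pi> :: nat \<Rightarrow> nat\<close> with \<open>\<pi> permutes {1..n}\<close>;
  positions and values both range over \<open>{1..n}\<close>, and \<open>\<pi> i\<close> is the value at position \<open>i\<close>.
\<close>

definition inversions :: "nat \<Rightarrow> (nat \<Rightarrow> nat) \<Rightarrow> nat" where
  "inversions n \<pi> = card {(i, j). i \<in> {1..n} \<and> j \<in> {1..n} \<and> i < j \<and> \<pi> i > \<pi> j}"

definition P :: "real \<Rightarrow> nat \<Rightarrow> real" where
  "P \<theta> n = (\<Sum>i<n. \<theta> ^ i)"

definition P_fact :: "real \<Rightarrow> nat \<Rightarrow> real" where
  "P_fact \<theta> n = (\<Prod>i=1..n. P \<theta> i)"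

definition left_to_right_max :: "(nat \<Rightarrow> nat) \<Rightarrow> nat \<Rightarrow> bool" where
  "left_to_right_max \<pi> i \<longleftrightarrow> (\<forall>j. 1 \<le> j \<and> j < i \<longrightarrow> \<pi> j < \<pi> i)"

text \<open>
  The position accepted by the strategy \<open>S\<^sup>1\<^sub>k\<close>; \<open>None\<close> means that no candidate is accepted.
\<close>

definition strategy1 :: "nat \<Rightarrow> nat \<Rightarrow> (nat \<Rightarrow> nat) \<Rightarrow> nat option" where
  "strategy1 k n \<pi> =
     (if \<exists>i. k < i \<and> i \<le> n \<and> left_to_right_max \<pi> i
      then Some (LEAST i. k < i \<and> i \<le> n \<and> left_to_right_max \<pi> i)
      else None)"

definition winnable :: "nat \<Rightarrow> nat \<Rightarrow> (nat \<Rightarrow> nat) \<Rightarrow> bool" where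
  "winnable k n \<pi> \<longleftrightarrow> (\<exists>i. strategy1 k n \<pi> = Some i \<and> \<pi> i = n - 1)"

definition W1_star :: "real \<Rightarrow> nat \<Rightarrow> nat \<Rightarrow> real" where
  "W1_star \<theta> n k = (\<Sum>\<pi> | \<pi> permutes {1..n} \<and> winnable k n \<pi>. \<theta> ^ inversions n \<pi>)"

end

theory Submission
  imports Defs
begin

text \<open>
  Build a permutation of \<open>{1..n+1}\<close> from one of \<open>{1..n}\<close> by appending a last entry that is
  smaller than exactly \<open>c\<close> of the earlier ones; this multiplies the weight \<open>\<theta>\<^sup>i\<^sup>n\<^sup>v\<close> by \<open>\<theta>\<^sup>c\<close> and
  preserves all earlier comparisons. Let \<open>A\<close>, \<open>B\<close>, \<open>C\<close> be the total weights of the permutations in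
  which nothing has been accepted yet, the accepted entry is the largest so far, and the accepted
  entry is the second largest so far. Distinguishing \<open>c = 0\<close>, \<open>c = 1\<close> and \<open>c \<ge> 2\<close> gives, for
  \<open>n \<ge> k\<close>, the linear recurrences
  \<open>A (n+1) = \<theta> P\<^sub>n A n\<close>, \<open>B (n+1) = A n + \<theta> P\<^sub>n B n\<close>, \<open>C (n+1) = B n + \<theta>\<^sup>2 P\<^bsub>n-1\<^esub> C n\<close>,
  whose solution yields the formula, since \<open>C = W\<^sub>1\<^sup>*\<close>.
\<close>

section \<open>Appending a last entry to a permutation\<close>

text \<open>
  Acting on values, \<open>shift_cycle n c\<close> makes room for the value \<open>n + 1 - c\<close> and moves \<open>n + 1\<close> there,
  so that \<open>shift_cycle n c \<circ> \<sigma>\<close> is \<open>\<sigma>\<close> with this entry appended.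
\<close>

definition shift_cycle :: "nat \<Rightarrow> nat \<Rightarrow> nat \<Rightarrow> nat" where
  "shift_cycle n c x =
     (if x = Suc n then Suc n - c else if Suc n - c \<le> x \<and> x \<le> n then Suc x else x)"

lemma shift_cycle_permutes:
  assumes "c \<le> n"
  shows "shift_cycle n c permutes {1..Suc n}"
proof (rule bij_imp_permutes)
  have "inj_on (shift_cycle n c) {1..Suc n}"
    using assms by (auto simp: inj_on_def shift_cycle_def split: if_splits)
  moreover have "shift_cycle n c ` {1..Suc n} \<subseteq> {1..Suc n}"
    using assms by (auto simp: shift_cycle_def)
  ultimately show "bij_betw (shift_cycle n c) {1..Suc n} {1..Suc n}"
    by (simp add: bij_betw_def endo_inj_surj)
qed (use assms in \<open>auto simp: shift_cycle_def\<close>)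

lemma shift_cycle_less_iff:
  "x \<le> n \<Longrightarrow> y \<le> n \<Longrightarrow> shift_cycle n c x < shift_cycle n c y \<longleftrightarrow> x < y"
  by (auto simp: shift_cycle_def)

lemma permutes_atLeastAtMost_bounds:
  assumes "\<sigma> permutes {1..n::nat}" "1 \<le> i" "i \<le> n"
  shows "1 \<le> \<sigma> i" "\<sigma> i \<le> n"
  using permutes_in_image[OF assms(1), of i] assms(2,3) by auto

lemma permutes_Suc_fixed:
  assumes "\<sigma> permutes {1..n::nat}"
  shows "\<sigma> (Suc n) = Suc n"
  using assms by (auto simp: permutes_def)

lemma append_entry_permutes:
  assumes "\<sigma> permutes {1..n}" "c \<le> n"
  shows "shift_cycle n c \<circ> \<sigma> permutes {1..Suc n}"
  using permutes_subset[OF assms(1), of "{1..Suc n}"] shift_cycle_permutes[OF assms(2)]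
  by (intro permutes_compose) auto

text \<open>The last entry \<open>Suc n - c\<close> determines \<open>c\<close>, and then
  injectivity of \<open>shift_cycle n c\<close> recovers \<open>\<sigma>\<close>. Surjectivity
  follows by counting, since (n+1) n! = (n+1)!.\<close>

lemma append_entry_bij:
  "bij_betw (\<lambda>(c, \<sigma>). shift_cycle n c \<circ> \<sigma>)
     ({..<Suc n} \<times> {\<sigma>. \<sigma> permutes {1..n}}) {\<pi>. \<pi> permutes {1..Suc n}}"
proof -
  let ?D = "{..<Suc n} \<times> {\<sigma>. \<sigma> permutes {1..n}}"
  let ?f = "\<lambda>(c, \<sigma>). shift_cycle n c \<circ> \<sigma>"
  have inj: "inj_on ?f ?D"
  proof (clarsimp simp: inj_on_def)
    fix c \<sigma> c' \<sigma>'
    assume c: "c < Suc n" "c' < Suc n"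
      and \<sigma>: "\<sigma> permutes {Suc 0..n}" "\<sigma>' permutes {Suc 0..n}"
      and eq: "shift_cycle n c \<circ> \<sigma> = shift_cycle n c' \<circ> \<sigma>'"
    have "shift_cycle n c (Suc n) = shift_cycle n c' (Suc n)"
      using fun_cong[OF eq, of "Suc n"] \<sigma> by (simp add: permutes_Suc_fixed)
    then have "c = c'" using c by (simp add: shift_cycle_def)
    moreover have "inj (shift_cycle n c)"
      using shift_cycle_permutes[of c n] c permutes_inj by force
    ultimately show "c = c' \<and> \<sigma> = \<sigma>'"
      using eq by (auto simp: inj_def fun_eq_iff)
  qed
  have "?f ` ?D = {\<pi>. \<pi> permutes {1..Suc n}}"
  proof (rule card_subset_eq)
    show "finite {\<pi>. \<pi> permutes {1..Suc n}}" by (simp add: finite_permutations)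
    show "?f ` ?D \<subseteq> {\<pi>. \<pi> permutes {1..Suc n}}"
      using append_entry_permutes by auto
    show "card (?f ` ?D) = card {\<pi>. \<pi> permutes {1..Suc n}}"
      using inj by (simp add: card_image card_cartesian_product card_permutations)
  qed
  with inj show ?thesis by (simp add: bij_betw_def)
qed

lemma inversions_append_entry:
  assumes \<sigma>: "\<sigma> permutes {1..n}" and c: "c \<le> n"
  shows "inversions (Suc n) (shift_cycle n c \<circ> \<sigma>) = c + inversions n \<sigma>"
proof -
  let ?\<pi> = "shift_cycle n c \<circ> \<sigma>"
  let ?I = "{(i, j). i \<in> {1..n} \<and> j \<in> {1..n} \<and> i < j \<and> \<sigma> i > \<sigma> j}"
  let ?L = "{i \<in> {1..n}. Suc n - c \<le> \<sigma> i}"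
  note bd = permutes_atLeastAtMost_bounds[OF \<sigma>]
  have last: "?\<pi> (Suc n) = Suc n - c"
    using \<sigma> by (simp add: permutes_Suc_fixed shift_cycle_def)
  have old: "?\<pi> i > ?\<pi> j \<longleftrightarrow> \<sigma> i > \<sigma> j" if "i \<in> {1..n}" "j \<in> {1..n}" for i j
    using bd[of i] bd[of j] that by (simp add: shift_cycle_less_iff)
  have new: "?\<pi> i > ?\<pi> (Suc n) \<longleftrightarrow> Suc n - c \<le> \<sigma> i" if "i \<in> {1..n}" for i
    using bd[of i] that unfolding last by (auto simp: shift_cycle_def)
  \<comment> \<open>Inversions are split by whether the later position is the new one.\<close>
  have "{(i, j). i \<in> {1..Suc n} \<and> j \<in> {1..Suc n} \<and> i < j \<and> ?\<pi> i > ?\<pi> j}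
        = ?I \<union> ?L \<times> {Suc n}" (is "?J = _")
  proof (intro set_eqI, clarify)
    fix i j
    show "(i, j) \<in> ?J \<longleftrightarrow> (i, j) \<in> ?I \<union> ?L \<times> {Suc n}"
    proof (cases "j = Suc n")
      case True
      then show ?thesis using new[of i] by auto
    next
      case False
      then show ?thesis using old[of i j] by auto
    qed
  qed
  moreover have "finite ?I"
    by (rule finite_subset[of _ "{1..n} \<times> {1..n}"]) auto
  \<comment> \<open>The entries in \<open>?L\<close> carry exactly the \<open>c\<close> largest
    values of \<open>\<sigma>\<close>.\<close>
  moreover have "card ?L = c"
  proof -
    have "\<sigma> ` ?L = {Suc n - c..n}"
    proof (intro equalityI subsetI)
      fix v assume v: "v \<in> {Suc n - c..n}"
      then have "v \<in> \<sigma> ` {1..n}" using permutes_image[OF \<sigma>] c by auto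
      then show "v \<in> \<sigma> ` ?L" using v by auto
    qed (use bd in auto)
    then have "card {Suc n - c..n} = card ?L"
      using card_image[OF permutes_inj_on[OF \<sigma>], of ?L] by simp
    then show ?thesis using c by simp
  qed
  moreover have "?I \<inter> ?L \<times> {Suc n} = {}" by auto
  moreover have "finite (?L \<times> {Suc n})" by simp
  ultimately show ?thesis
    unfolding inversions_def
    by (simp only: card_Un_disjoint card_cartesian_product) simp
qed

section \<open>Weights of events under the unnormalised Mallows measure\<close>

definition Mallows_weight :: "real \<Rightarrow> nat \<Rightarrow> ((nat \<Rightarrow> nat) \<Rightarrow> bool) \<Rightarrow> real" where
  "Mallows_weight \<theta> n Q = (\<Sum>\<pi> | \<pi> permutes {1..n} \<and> Q \<pi>. \<theta> ^ inversions n \<pi>)"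

lemma Mallows_weight_cong:
  "(\<And>\<pi>. \<pi> permutes {1..n} \<Longrightarrow> Q \<pi> \<longleftrightarrow> R \<pi>) \<Longrightarrow> Mallows_weight \<theta> n Q = Mallows_weight \<theta> n R"
  unfolding Mallows_weight_def by (intro sum.cong) auto

lemma Mallows_weight_False [simp]: "Mallows_weight \<theta> n (\<lambda>_. False) = 0"
  by (simp add: Mallows_weight_def)

text \<open>Reindexing along \<open>append_entry_bij\<close>. Every recurrence below comes from
  describing the pulled-back event for each \<open>c\<close>.\<close>

lemma Mallows_weight_Suc:
  "Mallows_weight \<theta> (Suc n) Q =
     (\<Sum>c<Suc n. \<theta> ^ c * Mallows_weight \<theta> n (\<lambda>\<sigma>. Q (shift_cycle n c \<circ> \<sigma>)))"
proof -
  let ?S = "\<lambda>n. {\<pi>. \<pi> permutes {1..n::nat}}"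
  have fin: "finite (?S m)" for m by (simp add: finite_permutations)
  have eq: "Mallows_weight \<theta> m R = (\<Sum>\<pi>\<in>?S m. if R \<pi> then \<theta> ^ inversions m \<pi> else 0)" for m R
    unfolding Mallows_weight_def by (subst sum.inter_filter[OF fin, symmetric]) simp
  have "Mallows_weight \<theta> (Suc n) Q =
      (\<Sum>(c, \<sigma>)\<in>{..<Suc n} \<times> ?S n. if Q (shift_cycle n c \<circ> \<sigma>)
         then \<theta> ^ inversions (Suc n) (shift_cycle n c \<circ> \<sigma>) else 0)"
    unfolding eq sum.reindex_bij_betw[OF append_entry_bij, symmetric]
    by (intro sum.cong refl) (simp add: case_prod_unfold)
  also have "\<dots> = (\<Sum>c<Suc n. \<Sum>\<sigma>\<in>?S n. if Q (shift_cycle n c \<circ> \<sigma>)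
         then \<theta> ^ inversions (Suc n) (shift_cycle n c \<circ> \<sigma>) else 0)"
    by (rule sum.cartesian_product[symmetric])
  also have "\<dots> = (\<Sum>c<Suc n. \<theta> ^ c * Mallows_weight \<theta> n (\<lambda>\<sigma>. Q (shift_cycle n c \<circ> \<sigma>)))"
    unfolding eq sum_distrib_left
    by (intro sum.cong refl) (auto simp: inversions_append_entry power_add)
  finally show ?thesis .
qed

lemma P_Suc: "P \<theta> (Suc n) = 1 + \<theta> * P \<theta> n"
  unfolding P_def by (subst sum.lessThan_Suc_shift) (simp add: sum_distrib_left)

lemma P_fact_Suc: "P_fact \<theta> (Suc n) = P \<theta> (Suc n) * P_fact \<theta> n"
  by (simp add: P_fact_def)

lemma P_pos:
  assumes "\<theta> > 0" "n > 0"
  shows "P \<theta> n > 0"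
  unfolding P_def using assms by (intro sum_pos) auto

lemma Mallows_weight_True: "Mallows_weight \<theta> n (\<lambda>_. True) = P_fact \<theta> n"
proof (induction n)
  case 0
  have "{(i, j). i = Suc 0 \<and> False} = ({} :: (nat \<times> nat) set)" by simp
  then show ?case by (simp add: Mallows_weight_def P_fact_def inversions_def)
next
  case (Suc n)
  show ?case
    unfolding Mallows_weight_Suc Suc.IH P_fact_Suc P_def by (simp only: sum_distrib_right)
qed

section \<open>Records and the strategy under appending\<close>

lemma left_to_right_max_append_entry:
  assumes \<sigma>: "\<sigma> permutes {1..n}" and i: "1 \<le> i" "i \<le> n"
  shows "left_to_right_max (shift_cycle n c \<circ> \<sigma>) i \<longleftrightarrow> left_to_right_max \<sigma> i"
proof -
  have "shift_cycle n c (\<sigma> j) < shift_cycle n c (\<sigma> i) \<longleftrightarrow> \<sigma> j < \<sigma> i" if "1 \<le> j" "j < i" for j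
    using permutes_atLeastAtMost_bounds[OF \<sigma>, of i] permutes_atLeastAtMost_bounds[OF \<sigma>, of j]
      that i by (intro shift_cycle_less_iff) auto
  then show ?thesis by (auto simp: left_to_right_max_def)
qed

lemma left_to_right_max_new_entry:
  assumes \<sigma>: "\<sigma> permutes {1..n}" and c: "c \<le> n"
  shows "left_to_right_max (shift_cycle n c \<circ> \<sigma>) (Suc n) \<longleftrightarrow> c = 0"
proof
  note bd = permutes_atLeastAtMost_bounds[OF \<sigma>]
  have last: "\<sigma> (Suc n) = Suc n" using \<sigma> by (rule permutes_Suc_fixed)
  {
    assume "c = 0"
    then have "shift_cycle n c (\<sigma> j) < shift_cycle n c (Suc n)" if "1 \<le> j" "j < Suc n" for j
      using bd[of j] that by (simp add: shift_cycle_def)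
    then show "left_to_right_max (shift_cycle n c \<circ> \<sigma>) (Suc n)"
      by (simp add: left_to_right_max_def last)
  }
  assume L: "left_to_right_max (shift_cycle n c \<circ> \<sigma>) (Suc n)"
  show "c = 0"
  proof (rule ccontr)
    assume "c \<noteq> 0"
    \<comment> \<open>If \<open>c\<close> is nonzero, the entry of value \<open>n\<close> is lifted
      to \<open>Suc n\<close> and beats the new last entry.\<close>
    then have "n \<in> \<sigma> ` {1..n}" using c permutes_image[OF \<sigma>] by auto
    then obtain j where "j \<in> {1..n}" "\<sigma> j = n" by auto
    with L have "shift_cycle n c n < shift_cycle n c (Suc n)"
      unfolding left_to_right_max_def o_def last by force
    then show False using \<open>c \<noteq> 0\<close> c by (simp add: shift_cycle_def split: if_splits)
  qed
qed

lemma strategy1_eq_None_iff: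
  "strategy1 k n \<pi> = None \<longleftrightarrow> (\<forall>i. k < i \<and> i \<le> n \<longrightarrow> \<not> left_to_right_max \<pi> i)"
  by (auto simp: strategy1_def)

lemma strategy1_eq_Some_iff:
  "strategy1 k n \<pi> = Some i \<longleftrightarrow>
     k < i \<and> i \<le> n \<and> left_to_right_max \<pi> i \<and> (\<forall>j. k < j \<and> j < i \<longrightarrow> \<not> left_to_right_max \<pi> j)"
  (is "?l \<longleftrightarrow> ?r")
proof
  let ?Q = "\<lambda>i. k < i \<and> i \<le> n \<and> left_to_right_max \<pi> i"
  {
    assume ?l
    then have ex: "\<exists>i. ?Q i" and i: "i = (LEAST i. ?Q i)"
      by (auto simp: strategy1_def split: if_splits)
    from LeastI_ex[OF ex] have "?Q i" unfolding i .
    moreover have "\<not> ?Q j" if "j < i" for j using not_less_Least that unfolding i by blast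
    ultimately show ?r by auto
  }
  assume r: ?r
  then have "(LEAST i. ?Q i) = i"
    by (intro Least_equality) (auto simp: not_less[symmetric])
  with r show ?l by (auto simp: strategy1_def)
qed

text \<open>The strategy decides online from relative order, so an earlier acceptance persists.
  Otherwise the new entry is taken exactly when it is a record; \<open>k \<le> n\<close> puts its
  position past the rejection phase.\<close>

lemma strategy1_append_entry:
  assumes \<sigma>: "\<sigma> permutes {1..n}" and c: "c \<le> n" and k: "k \<le> n"
  shows "strategy1 k (Suc n) (shift_cycle n c \<circ> \<sigma>) =
     (case strategy1 k n \<sigma> of Some i \<Rightarrow> Some i | None \<Rightarrow> if c = 0 then Some (Suc n) else None)"
proof (cases "strategy1 k n \<sigma>")
  note old = left_to_right_max_append_entry[OF \<sigma>] and new = left_to_right_max_new_entry[OF \<sigma> c]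
  {
    case None
    then have none: "\<not> left_to_right_max (shift_cycle n c \<circ> \<sigma>) i" if "k < i" "i \<le> n" for i
      using that by (auto simp: strategy1_eq_None_iff old)
    show ?thesis
    proof (cases "c = 0")
      case True
      then have "strategy1 k (Suc n) (shift_cycle n c \<circ> \<sigma>) = Some (Suc n)"
        using new k none unfolding strategy1_eq_Some_iff by auto
      then show ?thesis using True None by simp
    next
      case False
      then have "strategy1 k (Suc n) (shift_cycle n c \<circ> \<sigma>) = None"
        using new none unfolding strategy1_eq_None_iff by (auto simp: le_Suc_eq)
      then show ?thesis using False None by simp
    qed
  next
    case (Some i)
    then have "strategy1 k (Suc n) (shift_cycle n c \<circ> \<sigma>) = Some i"
      unfolding strategy1_eq_Some_iff using old by auto
    then show ?thesis using Some by simp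
  }
qed

text \<open>The target value is a parameter because later entries can raise the accepted value:
  \<open>v = n\<close> gives the event of \<open>B\<close>, \<open>v = n - 1\<close> that of
  \<open>C\<close>.\<close>

definition accepts_value :: "nat \<Rightarrow> nat \<Rightarrow> nat \<Rightarrow> (nat \<Rightarrow> nat) \<Rightarrow> bool" where
  "accepts_value k n v \<pi> \<longleftrightarrow> (\<exists>i. strategy1 k n \<pi> = Some i \<and> \<pi> i = v)"

lemma W1_star_eq: "W1_star \<theta> n k = Mallows_weight \<theta> n (accepts_value k n (n - 1))"
  by (simp add: W1_star_def Mallows_weight_def winnable_def accepts_value_def)

lemma accepts_value_append_entry:
  assumes \<sigma>: "\<sigma> permutes {1..n}" and c: "c \<le> n" and k: "k \<le> n"
  shows "accepts_value k (Suc n) v (shift_cycle n c \<circ> \<sigma>) \<longleftrightarrow>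
    (\<exists>u. 1 \<le> u \<and> u \<le> n \<and> accepts_value k n u \<sigma> \<and> shift_cycle n c u = v)
    \<or> strategy1 k n \<sigma> = None \<and> c = 0 \<and> v = Suc n"
proof (cases "strategy1 k n \<sigma>")
  case None
  then show ?thesis
    using \<sigma> by (auto simp: accepts_value_def strategy1_append_entry[OF assms]
      permutes_Suc_fixed shift_cycle_def)
next
  case (Some i)
  then have "1 \<le> i" "i \<le> n" by (auto simp: strategy1_eq_Some_iff)
  from permutes_atLeastAtMost_bounds[OF \<sigma> this] Some show ?thesis
    by (auto simp: accepts_value_def strategy1_append_entry[OF assms])
qed

section \<open>The three recurrences\<close>

text \<open>With nothing accepted before, \<open>c = 0\<close> would be accepted. The remaining
  \<open>c\<close> from 1 to \<open>n\<close> contribute the factor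
  \<open>\<theta> * P \<theta> n\<close>.\<close>

lemma weight_None_Suc:
  assumes "k \<le> n"
  shows "Mallows_weight \<theta> (Suc n) (\<lambda>\<pi>. strategy1 k (Suc n) \<pi> = None) =
    \<theta> * P \<theta> n * Mallows_weight \<theta> n (\<lambda>\<pi>. strategy1 k n \<pi> = None)"
proof -
  have "Mallows_weight \<theta> n (\<lambda>\<sigma>. strategy1 k (Suc n) (shift_cycle n c \<circ> \<sigma>) = None) =
     (if c = 0 then 0 else Mallows_weight \<theta> n (\<lambda>\<pi>. strategy1 k n \<pi> = None))" if "c < Suc n" for c
    using that assms
    by (auto intro!: Mallows_weight_cong trans[OF Mallows_weight_cong Mallows_weight_False]
      simp: strategy1_append_entry split: option.splits)
  then have "Mallows_weight \<theta> (Suc n) (\<lambda>\<pi>. strategy1 k (Suc n) \<pi> = None) =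
      (\<Sum>c<Suc n. \<theta> ^ c * (if c = 0 then 0
         else Mallows_weight \<theta> n (\<lambda>\<pi>. strategy1 k n \<pi> = None)))"
    unfolding Mallows_weight_Suc by (intro sum.cong) auto
  also have "\<dots> = \<theta> * P \<theta> n * Mallows_weight \<theta> n (\<lambda>\<pi>. strategy1 k n \<pi> = None)"
    by (subst sum.lessThan_Suc_shift) (simp add: P_def sum_distrib_left sum_distrib_right)
  finally show ?thesis .
qed

text \<open>For \<open>c = 0\<close> the new entry is the maximum, so it must itself be the accepted
  one. For \<open>c \<ge> 1\<close> the old maximum stays the maximum.\<close>

lemma weight_accepts_max_Suc:
  assumes "k \<le> n"
  shows "Mallows_weight \<theta> (Suc n) (accepts_value k (Suc n) (Suc n)) =
    Mallows_weight \<theta> n (\<lambda>\<pi>. strategy1 k n \<pi> = None) +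
    \<theta> * P \<theta> n * Mallows_weight \<theta> n (accepts_value k n n)" (is "_ = ?A + _ * ?B")
proof -
  have "Mallows_weight \<theta> n (\<lambda>\<sigma>. accepts_value k (Suc n) (Suc n) (shift_cycle n c \<circ> \<sigma>)) =
     (if c = 0 then ?A else ?B)" if c: "c < Suc n" for c
  proof -
    have "accepts_value k (Suc n) (Suc n) (shift_cycle n c \<circ> \<sigma>) \<longleftrightarrow>
      (if c = 0 then strategy1 k n \<sigma> = None else accepts_value k n n \<sigma>)"
      if "\<sigma> permutes {1..n}" for \<sigma>
      using c that assms
      by (subst accepts_value_append_entry)
        (auto simp: shift_cycle_def split: if_splits intro!: exI[of _ n])
    then show ?thesis by (auto intro!: Mallows_weight_cong)
  qed
  then have "Mallows_weight \<theta> (Suc n) (accepts_value k (Suc n) (Suc n)) =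
      (\<Sum>c<Suc n. \<theta> ^ c * (if c = 0 then ?A else ?B))"
    unfolding Mallows_weight_Suc by (intro sum.cong) auto
  also have "\<dots> = ?A + \<theta> * P \<theta> n * ?B"
    by (subst sum.lessThan_Suc_shift) (simp add: P_def sum_distrib_left sum_distrib_right)
  finally show ?thesis .
qed

text \<open>For \<open>c = 0\<close> an accepted maximum drops to second place. For
  \<open>c = 1\<close> the new entry is second largest but no record, so it is not accepted. For
  \<open>c \<ge> 2\<close> the second place is unchanged, and these \<open>c\<close> sum to
  \<open>\<theta>\<^sup>2 * P \<theta> n\<close>.\<close>

lemma weight_accepts_second_Suc:
  assumes "k \<le> Suc n"
  shows "Mallows_weight \<theta> (Suc (Suc n)) (accepts_value k (Suc (Suc n)) (Suc n)) =
    Mallows_weight \<theta> (Suc n) (accepts_value k (Suc n) (Suc n)) +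
    \<theta>\<^sup>2 * P \<theta> n * Mallows_weight \<theta> (Suc n) (accepts_value k (Suc n) n)" (is "_ = ?B + _ * ?C")
proof -
  have "Mallows_weight \<theta> (Suc n)
          (\<lambda>\<sigma>. accepts_value k (Suc (Suc n)) (Suc n) (shift_cycle (Suc n) c \<circ> \<sigma>)) =
     (if c = 0 then ?B else if c = 1 then 0 else ?C)" if c: "c < Suc (Suc n)" for c
  proof -
    have "accepts_value k (Suc (Suc n)) (Suc n) (shift_cycle (Suc n) c \<circ> \<sigma>) \<longleftrightarrow>
      (if c = 0 then accepts_value k (Suc n) (Suc n) \<sigma>
       else if c = 1 then False else accepts_value k (Suc n) n \<sigma>)"
      if \<sigma>: "\<sigma> permutes {1..Suc n}" for \<sigma>
    proof -
      have "shift_cycle (Suc n) c u = Suc n \<longleftrightarrow> (if c = 0 then u = Suc n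
          else if c = 1 then False else u = n)" if "1 \<le> u" "u \<le> Suc n" for u
        using c that by (auto simp: shift_cycle_def)
      \<comment> \<open>Makes the preimage \<open>u = n\<close> an admissible value when
        \<open>c \<ge> 2\<close>.\<close>
      moreover have "n \<noteq> 0" if "c \<noteq> 0" "c \<noteq> 1" using c that by linarith
      ultimately show ?thesis
        using c by (subst accepts_value_append_entry[OF \<sigma> _ assms])
          (auto intro: exI[of _ n] exI[of _ "Suc n"])
    qed
    then show ?thesis
      by (auto intro!: Mallows_weight_cong trans[OF Mallows_weight_cong Mallows_weight_False])
  qed
  then have "Mallows_weight \<theta> (Suc (Suc n)) (accepts_value k (Suc (Suc n)) (Suc n)) =
      (\<Sum>c<Suc (Suc n). \<theta> ^ c * (if c = 0 then ?B else if c = 1 then 0 else ?C))"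
    unfolding Mallows_weight_Suc[of _ "Suc n"] by (intro sum.cong) auto
  also have "\<dots> = ?B + \<theta>\<^sup>2 * P \<theta> n * ?C"
    unfolding sum.lessThan_Suc_shift
    by (simp add: P_def sum_distrib_left sum_distrib_right power2_eq_square mult.assoc)
  finally show ?thesis .
qed

section \<open>Solving the recurrences\<close>

context
  fixes \<theta> :: real and k :: nat
  assumes \<theta>: "\<theta> > 0" and k: "k \<ge> 1"
begin

text \<open>The product of the factors \<open>\<theta> * P \<theta> n\<close> for \<open>n\<close>
  from \<open>k\<close> to \<open>k + d - 1\<close>, applied to \<open>P_fact \<theta> k\<close>.
  The quotient form is the one that is summed for \<open>B\<close>; \<open>k \<ge> 1\<close> keeps
  its denominators positive.\<close>

lemma weight_None_closed:
  "Mallows_weight \<theta> (k + d) (\<lambda>\<pi>. strategy1 k (k + d) \<pi> = None) =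
     \<theta> ^ d * P_fact \<theta> (k + d) * (P \<theta> k / P \<theta> (k + d))"
proof (induction d)
  case 0
  \<comment> \<open>No position beyond \<open>k\<close> exists yet, so every permutation
    counts.\<close>
  have "Mallows_weight \<theta> k (\<lambda>\<pi>. strategy1 k k \<pi> = None) = P_fact \<theta> k"
    unfolding Mallows_weight_True[symmetric]
    by (rule Mallows_weight_cong) (auto simp: strategy1_eq_None_iff)
  then show ?case using P_pos[OF \<theta>, of k] k by simp
next
  case (Suc d)
  then show ?case
    using P_pos[OF \<theta>, of "k + d"] P_pos[OF \<theta>, of "Suc (k + d)"] k
    by (simp add: weight_None_Suc P_fact_Suc)
qed

text \<open>After division by \<open>\<theta> ^ d * P_fact \<theta> (k + d)\<close>, each step of
  the recurrence just adds the normalised \<open>A\<close> term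
  \<open>P \<theta> k / P \<theta> (k + d)\<close>.\<close>

lemma weight_accepts_max_closed:
  "Mallows_weight \<theta> (Suc (k + d)) (accepts_value k (Suc (k + d)) (Suc (k + d))) =
     \<theta> ^ d * P_fact \<theta> (k + d) * (\<Sum>j\<le>d. P \<theta> k / P \<theta> (k + j))"
proof (induction d)
  case 0
  have "Mallows_weight \<theta> k (accepts_value k k k) = 0"
    by (rule trans[OF Mallows_weight_cong Mallows_weight_False])
      (simp add: accepts_value_def strategy1_eq_Some_iff)
  then show ?case using weight_accepts_max_Suc[of k k \<theta>] weight_None_closed[of 0] by simp
next
  case (Suc d)
  then show ?case
    using weight_accepts_max_Suc[of k "Suc (k + d)" \<theta>] weight_None_closed[of "Suc d"]
    by (simp add: P_fact_Suc distrib_left mult_ac)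
qed

lemma W1_star_Suc: "W1_star \<theta> (Suc k) k = 0"
proof -
  \<comment> \<open>The recurrence for \<open>C\<close> is used at size \<open>Suc m = k\<close>,
    where nothing can be accepted and both of its terms vanish.\<close>
  obtain m where m: "k = Suc m" using k by (cases k) auto
  have "Mallows_weight \<theta> k (accepts_value k k v) = 0" for v
    by (rule trans[OF Mallows_weight_cong Mallows_weight_False])
      (simp add: accepts_value_def strategy1_eq_Some_iff)
  then show ?thesis
    using weight_accepts_second_Suc[of k m \<theta>] m by (simp add: W1_star_eq)
qed

text \<open>Normalising by \<open>P_fact \<theta> (k + d) * \<theta> ^ d\<close> leaves a sum
  \<open>T d\<close> with \<open>T (d+1) = (\<Sum>j\<le>d+1. q j) + \<theta> * T d\<close>, where
  \<open>q j = P \<theta> k / P \<theta> (k + j)\<close>. The coefficient of each \<open>q j\<close>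
  thus evolves by \<open>P_Suc\<close>.\<close>

lemma W1_star_closed:
  "W1_star \<theta> (Suc (Suc (k + d))) k =
     P_fact \<theta> (k + d) * \<theta> ^ d * (\<Sum>j\<le>d. P \<theta> (Suc d - j) * (P \<theta> k / P \<theta> (k + j)))"
proof (induction d)
  case 0
  have "P \<theta> (Suc 0) = 1" by (simp add: P_def)
  with W1_star_Suc weight_accepts_second_Suc[of k k \<theta>] weight_accepts_max_closed[of 0]
  show ?case by (simp add: W1_star_eq)
next
  case (Suc d)
  let ?q = "\<lambda>j. P \<theta> k / P \<theta> (k + j)"
  let ?F = "P_fact \<theta> (Suc (k + d)) * \<theta> ^ Suc d"
  have "W1_star \<theta> (Suc (Suc (k + Suc d))) k =
      \<theta> ^ Suc d * P_fact \<theta> (k + Suc d) * (\<Sum>j\<le>Suc d. ?q j) +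
      \<theta>\<^sup>2 * P \<theta> (Suc (k + d)) * W1_star \<theta> (Suc (Suc (k + d))) k"
    using weight_accepts_second_Suc[of k "Suc (k + d)" \<theta>] weight_accepts_max_closed[of "Suc d"]
    by (simp add: W1_star_eq)
  also have "\<dots> = ?F * ((\<Sum>j\<le>Suc d. ?q j) + \<theta> * (\<Sum>j\<le>d. P \<theta> (Suc d - j) * ?q j))"
    unfolding Suc.IH by (simp only: add_Suc_right P_fact_Suc power_Suc power2_eq_square
      distrib_left mult_ac)
  also have "(\<Sum>j\<le>Suc d. ?q j) + \<theta> * (\<Sum>j\<le>d. P \<theta> (Suc d - j) * ?q j) =
      (\<Sum>j\<le>Suc d. P \<theta> (Suc (Suc d) - j) * ?q j)"
  proof -
    \<comment> \<open>The vanishing term \<open>j = Suc d\<close> lets both sums run over the same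
      range.\<close>
    have P0: "P \<theta> 0 = 0" by (simp add: P_def)
    have "\<theta> * (\<Sum>j\<le>d. P \<theta> (Suc d - j) * ?q j) = (\<Sum>j\<le>Suc d. \<theta> * P \<theta> (Suc d - j) * ?q j)"
      by (simp add: sum_distrib_left mult.assoc P0)
    then show ?thesis
      by (simp only: sum.distrib[symmetric])
        (intro sum.cong refl, simp add: Suc_diff_le P_Suc distrib_right add_divide_distrib)
  qed
  finally show ?case by simp
qed

end

theorem theorem11:
  fixes \<theta> :: real and k :: nat
  assumes "\<theta> > 0" and "\<theta> \<noteq> 1" and "k \<ge> 1"
  shows "(\<forall>N \<ge> k + 2. W1_star \<theta> N k =
            P_fact \<theta> (N - 2) * \<theta> ^ (N - k - 2) *
            ((1 - \<theta> ^ (N - k - 1)) / (1 - \<theta>) +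
             (\<Sum>j = 1..N - k - 2.
                (1 - \<theta> ^ (N - k - 1 - j)) / (1 - \<theta>) * ((1 - \<theta> ^ k) / (1 - \<theta> ^ (k + j))))))
         \<and> W1_star \<theta> (k + 1) k = 0
         \<and> W1_star \<theta> (k + 2) k = P_fact \<theta> k"
proof (intro conjI allI impI)
  note pos = P_pos[OF assms(1)]
  have P_eq: "P \<theta> n = (1 - \<theta> ^ n) / (1 - \<theta>)" for n
    using assms(2) sum_gp_strict[of \<theta> n] by (simp add: P_def)
  show "W1_star \<theta> (k + 1) k = 0"
    using W1_star_Suc[OF assms(1,3)] by simp
  have "P \<theta> (Suc 0) = 1" by (simp add: P_def)
  then show "W1_star \<theta> (k + 2) k = P_fact \<theta> k"
    using W1_star_closed[OF assms(1,3), of 0] pos[of k] assms(3) by simp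
  fix N assume "N \<ge> k + 2"
  then obtain d where N: "N = Suc (Suc (k + d))"
    by (metis add_2_eq_Suc' add_Suc less_eqE)
  \<comment> \<open>The term \<open>j = 0\<close> is split off; its quotient
    \<open>P \<theta> k / P \<theta> k\<close> is 1.\<close>
  have "(\<Sum>j\<le>d. P \<theta> (Suc d - j) * (P \<theta> k / P \<theta> (k + j))) =
      P \<theta> (Suc d) + (\<Sum>j = 1..d. P \<theta> (Suc d - j) * (P \<theta> k / P \<theta> (k + j)))"
    using pos[of k] assms(3)
    by (simp add: atMost_atLeast0 sum.atLeast_Suc_atMost[of 0 d])
  \<comment> \<open>In the quotient of two geometric sums the denominators
    \<open>1 - \<theta>\<close> cancel.\<close>
  also have "\<dots> = (1 - \<theta> ^ Suc d) / (1 - \<theta>) + (\<Sum>j = 1..d.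
      (1 - \<theta> ^ (Suc d - j)) / (1 - \<theta>) * ((1 - \<theta> ^ k) / (1 - \<theta> ^ (k + j))))"
    using assms(2) by (simp add: P_eq)
  finally show "W1_star \<theta> N k =
            P_fact \<theta> (N - 2) * \<theta> ^ (N - k - 2) *
            ((1 - \<theta> ^ (N - k - 1)) / (1 - \<theta>) +
             (\<Sum>j = 1..N - k - 2.
                (1 - \<theta> ^ (N - k - 1 - j)) / (1 - \<theta>) * ((1 - \<theta> ^ k) / (1 - \<theta> ^ (k + j)))))"
    using W1_star_closed[OF assms(1,3), of d] by (simp add: N)
qed

end
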